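(* Let $\alpha>0$, and let $f:\Omega\times\mathbb{N}\times\mathbb{R}^N\to\mathbb{R}$ be an adapted driver (independent of $y$) such that: (a) $f$ is Lipschitz in $z$: there is $L>0$ such that for any $t$ and any $\mathcal{F}_t$-measurable $\mathbb{R}^N$-valued $Z_t,Z'_t$, $|f(\omega,t,Z_t)-f(\omega,t,Z'_t)|\le L\|Z_t-Z'_t\|_{M_{t+1}}$ a.s.; (b) for any $t\ge0$, $z,z'\in\mathbb{R}^N$ and any atom $F$ of $\mathcal{F}_t$, with $\mathbb{J}_t^F:=\{i:\mathbb{P}(X_{t+1}=e_i\mid F)>0\}$, $$f(\omega,t,z)-f(\omega,t,z')>\min_{i\in\mathbb{J}_t^F}\big\{(z-z')^*(e_i-\mathbb{E}[X_{t+1}\mid\mathcal{F}_t])\big\}\quad\text{on }F,$$ unless this minimum equals $0$, in which case the inequality can be replaced by an equality; (c) $f(\omega,t,0)$ is uniformly bounded (in absolute value) by some $C>0$. Then there exists an adapted solution $(Y,Z)$ to the infinite horizon discounted BSDE $$Y_T=Y_t-\sum_{t\le u<T}\big(f(\omega,u,Z_u)-\alpha Y_u\big)+\sum_{t\le u<T}Z_u^*M_{u+1}\quad\text{a.s. for all }0\le t<T<\infty,$$ satisfying $|Y_t|\le C/\alpha$ for all $t$, and this solution is unique among bounded adapted solutions. Furthermore, if for each $T$, $(Y^T,Z^T)$ denotes the (unique) adapted solution to the finite horizon BSDE $$0=Y^T_t-\sum_{t\le u<T}\big(f(\omega,u,Z^T_u)-\alpha Y^T_u\big)+\sum_{t\le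 u<T}(Z^T_u)^*M_{u+1},\qquad 0\le t\le T,$$ then $Y^T_t\to Y_t$ in $L^\infty$ as $T\to\infty$, uniformly on finite sets in $t$.
   Context: Setting. $\mathcal{X}=\{e_1,\dots,e_N\}$ is the standard basis of $\mathbb{R}^N$ (column vectors; $*$ is transposition). $X=(X_t)_{t\ge0}$ is any $\mathcal{X}$-valued stochastic process in discrete time $t\in\mathbb{N}=\{0,1,2,\dots\}$ on a probability space $(\Omega,\mathcal{F},\mathbb{P})$ (not necessarily Markov), $\mathcal{F}_t$ is the $\mathbb{P}$-completion of $\sigma(X_0,\dots,X_t)$ (adding only subsets of null sets of $\sigma(X_0,\dots,X_t)$), $\mathcal{F}=\sigma(\bigcup_t\mathcal{F}_t)$. The atoms of $\mathcal{F}_t$ are the events of positive probability of the form $\{X_0=x_0,\dots,X_t=x_t\}$, up to null sets of $\mathcal{F}_t$. $M_{t+1}:=X_{t+1}-\mathbb{E}[X_{t+1}\mid\mathcal{F}_t]$. $f$ adapted means that for each $t$, $(\omega,z)\mapsto f(\omega,t,z)$ is $\mathcal{F}_t\otimes\mathcal{B}(\mathbb{R}^N)$-measurable; adapted processes are $\mathcal{F}_t$-measurable at each $t$. For $\mathcal{F}_t$-measurable $Z_t$, $\|Z_t\|^2_{M_{t+1}}:=\mathbb{E}[(Z_t^*M_{t+1})^2\mid\mathcal{F}_t]$. $Z\sim_MZ'$ means $\|Z_t-Z'_t\|_{M_{t+1}}=0$ a.s. for all $t$. A solution is a pair of adapted processes $(Y,Z)$ with values in $\mathbb{R}\times\mathbb{R}^N$;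 it is bounded if $Y$ is uniformly bounded. Uniqueness of solutions is understood up to indistinguishability for $Y$ and up to $\sim_M$ for $Z$. Relations between random variables hold up to null sets. *)

theory Defs
  imports "HOL-Probability.Probability" "HOL-Probability.Essential_Supremum"
begin

section \<open>Finite-state processes and their completed filtration\<close>

definition natural_algebra ::
    "'a measure \<Rightarrow> (nat \<Rightarrow> 'a \<Rightarrow> real^'n) \<Rightarrow> nat \<Rightarrow> 'a measure" where
  "natural_algebra M X t =
     sigma (space M) {X s -` A \<inter> space M | s A. s \<le> t \<and> A \<in> sets borel}"

text \<open>
  Completing the restriction of the measure to the natural algebra, rather than the measure on
  the whole space, adds only subsets of null sets of the natural algebra.
\<close>

definition filt ::
    "'a measure \<Rightarrow> (nat \<Rightarrow> 'a \<Rightarrow> real^'n) \<Rightarrow> nat \<Rightarrow> 'a measure" where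
  "filt M X t = completion (restr_to_subalg M (natural_algebra M X t))"

locale basis_process = prob_space M
  for M :: "'a measure" and X :: "nat \<Rightarrow> 'a \<Rightarrow> real^'n" +
  assumes random_variable_X: "\<And>t. X t \<in> borel_measurable M"
    and X_in_basis: "\<And>t \<omega>. \<omega> \<in> space M \<Longrightarrow> X t \<omega> \<in> range (\<lambda>i. axis i 1)"
    and sets_eq_generated: "sets M = sigma_sets (space M) (\<Union>t. sets (filt M X t))"

definition atom ::
    "'a measure \<Rightarrow> (nat \<Rightarrow> 'a \<Rightarrow> real^'n) \<Rightarrow> nat \<Rightarrow> 'a set \<Rightarrow> bool" where
  "atom M X t F \<longleftrightarrow> F \<in> sets (filt M X t) \<and> measure M F > 0 \<and>
     (\<exists>x. sym_diff F {\<omega> \<in> space M. \<forall>s\<le>t. X s \<omega> = x s} \<in> null_sets M)"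

definition vec_cond_exp ::
    "'a measure \<Rightarrow> 'a measure \<Rightarrow> ('a \<Rightarrow> real^'n) \<Rightarrow> 'a \<Rightarrow> real^'n" where
  "vec_cond_exp M G V = (\<lambda>\<omega>. \<chi> i. real_cond_exp M G (\<lambda>w. V w $ i) \<omega>)"

text \<open>
  The index of the martingale difference is shifted: \<open>mart_diff M X t\<close> is the difference
  $M_{t+1} = X_{t+1} - E[X_{t+1} | F_t]$ and \<open>mart_norm M X t\<close> is the random seminorm
  $\|\cdot\|_{M_{t+1}}$.
\<close>

definition mart_diff ::
    "'a measure \<Rightarrow> (nat \<Rightarrow> 'a \<Rightarrow> real^'n) \<Rightarrow> nat \<Rightarrow> 'a \<Rightarrow> real^'n" where
  "mart_diff M X t \<omega> = X (Suc t) \<omega> - vec_cond_exp M (filt M X t) (X (Suc t)) \<omega>"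

definition mart_norm ::
    "'a measure \<Rightarrow> (nat \<Rightarrow> 'a \<Rightarrow> real^'n) \<Rightarrow> nat \<Rightarrow> ('a \<Rightarrow> real^'n) \<Rightarrow> 'a \<Rightarrow> real" where
  "mart_norm M X t Z \<omega> =
     sqrt (real_cond_exp M (filt M X t) (\<lambda>w. (Z w \<bullet> mart_diff M X t w)\<^sup>2) \<omega>)"


section \<open>Drivers\<close>

definition adapted_driver ::
    "'a measure \<Rightarrow> (nat \<Rightarrow> 'a \<Rightarrow> real^'n) \<Rightarrow> ('a \<Rightarrow> nat \<Rightarrow> real^'n \<Rightarrow> real) \<Rightarrow> bool" where
  "adapted_driver M X f \<longleftrightarrow>
     (\<forall>t. (\<lambda>(\<omega>, z). f \<omega> t z) \<in> borel_measurable (filt M X t \<Otimes>\<^sub>M borel))"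

definition lipschitz_driver ::
    "'a measure \<Rightarrow> (nat \<Rightarrow> 'a \<Rightarrow> real^'n) \<Rightarrow> ('a \<Rightarrow> nat \<Rightarrow> real^'n \<Rightarrow> real) \<Rightarrow> real \<Rightarrow> bool" where
  "lipschitz_driver M X f L \<longleftrightarrow>
     (\<forall>t. \<forall>Z \<in> borel_measurable (filt M X t). \<forall>Z' \<in> borel_measurable (filt M X t).
        AE \<omega> in M. \<bar>f \<omega> t (Z \<omega>) - f \<omega> t (Z' \<omega>)\<bar>
                     \<le> L * mart_norm M X t (\<lambda>w. Z w - Z' w) \<omega>)"

definition possible_jumps ::
    "'a measure \<Rightarrow> (nat \<Rightarrow> 'a \<Rightarrow> real^'n) \<Rightarrow> nat \<Rightarrow> 'a set \<Rightarrow> 'n set" where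
  "possible_jumps M X t F = {i. \<P>(\<omega> in M. X (Suc t) \<omega> = axis i 1 \<bar> \<omega> \<in> F) > 0}"

definition min_jump ::
    "'a measure \<Rightarrow> (nat \<Rightarrow> 'a \<Rightarrow> real^'n) \<Rightarrow> nat \<Rightarrow> 'a set \<Rightarrow> real^'n \<Rightarrow> 'a \<Rightarrow> real" where
  "min_jump M X t F v \<omega> =
     Min ((\<lambda>i. v \<bullet> (axis i 1 - vec_cond_exp M (filt M X t) (X (Suc t)) \<omega>))
            ` possible_jumps M X t F)"

definition balanced_driver ::
    "'a measure \<Rightarrow> (nat \<Rightarrow> 'a \<Rightarrow> real^'n) \<Rightarrow> ('a \<Rightarrow> nat \<Rightarrow> real^'n \<Rightarrow> real) \<Rightarrow> bool" where
  "balanced_driver M X f \<longleftrightarrow>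
     (\<forall>t z z' F. atom M X t F \<longrightarrow>
        (AE \<omega> in M. \<omega> \<in> F \<longrightarrow>
           f \<omega> t z - f \<omega> t z' > min_jump M X t F (z - z') \<omega> \<or>
           (min_jump M X t F (z - z') \<omega> = 0 \<and>
            f \<omega> t z - f \<omega> t z' = min_jump M X t F (z - z') \<omega>)))"


section \<open>Solutions\<close>

definition bsde_infinite ::
    "'a measure \<Rightarrow> (nat \<Rightarrow> 'a \<Rightarrow> real^'n) \<Rightarrow> ('a \<Rightarrow> nat \<Rightarrow> real^'n \<Rightarrow> real) \<Rightarrow> real \<Rightarrow>
     (nat \<Rightarrow> 'a \<Rightarrow> real) \<Rightarrow> (nat \<Rightarrow> 'a \<Rightarrow> real^'n) \<Rightarrow> bool" where
  "bsde_infinite M X f \<alpha> Y Z \<longleftrightarrow>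
     (\<forall>t. Y t \<in> borel_measurable (filt M X t)) \<and>
     (\<forall>t. Z t \<in> borel_measurable (filt M X t)) \<and>
     (\<forall>t T. t < T \<longrightarrow>
        (AE \<omega> in M. Y T \<omega> = Y t \<omega> - (\<Sum>u\<in>{t..<T}. f \<omega> u (Z u \<omega>) - \<alpha> * Y u \<omega>)
                                 + (\<Sum>u\<in>{t..<T}. Z u \<omega> \<bullet> mart_diff M X u \<omega>)))"

definition bounded_process :: "'a measure \<Rightarrow> (nat \<Rightarrow> 'a \<Rightarrow> real) \<Rightarrow> bool" where
  "bounded_process M Y \<longleftrightarrow> (\<exists>K. \<forall>t. AE \<omega> in M. \<bar>Y t \<omega>\<bar> \<le> K)"

text \<open>
  With horizon \<open>T\<close> only the values of \<open>Y\<close> at times up to \<open>T\<close> and of \<open>Z\<close> at times before \<open>T\<close>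
  enter the equation; other values are unconstrained.
\<close>

definition bsde_finite ::
    "'a measure \<Rightarrow> (nat \<Rightarrow> 'a \<Rightarrow> real^'n) \<Rightarrow> ('a \<Rightarrow> nat \<Rightarrow> real^'n \<Rightarrow> real) \<Rightarrow> real \<Rightarrow> nat \<Rightarrow>
     (nat \<Rightarrow> 'a \<Rightarrow> real) \<Rightarrow> (nat \<Rightarrow> 'a \<Rightarrow> real^'n) \<Rightarrow> bool" where
  "bsde_finite M X f \<alpha> T Y Z \<longleftrightarrow>
     (\<forall>t\<le>T. Y t \<in> borel_measurable (filt M X t)) \<and>
     (\<forall>t<T. Z t \<in> borel_measurable (filt M X t)) \<and>
     (\<forall>t\<le>T. AE \<omega> in M. 0 = Y t \<omega> - (\<Sum>u\<in>{t..<T}. f \<omega> u (Z u \<omega>) - \<alpha> * Y u \<omega>)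
                                    + (\<Sum>u\<in>{t..<T}. Z u \<omega> \<bullet> mart_diff M X u \<omega>))"

definition M_equiv_at ::
    "'a measure \<Rightarrow> (nat \<Rightarrow> 'a \<Rightarrow> real^'n) \<Rightarrow> nat \<Rightarrow> ('a \<Rightarrow> real^'n) \<Rightarrow> ('a \<Rightarrow> real^'n) \<Rightarrow> bool" where
  "M_equiv_at M X t V V' \<longleftrightarrow> (AE \<omega> in M. mart_norm M X t (\<lambda>w. V w - V' w) \<omega> = 0)"

definition Linfty_norm :: "'a measure \<Rightarrow> ('a \<Rightarrow> real) \<Rightarrow> ennreal" where
  "Linfty_norm M g = esssup M (\<lambda>\<omega>. ennreal \<bar>g \<omega>\<bar>)"

end

theory Submission
  imports Defs
begin

text \<open>
  Up to null sets, everything known at time \<open>t\<close> is a function of the finitely many histories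
  \<open>X\<^sub>0, \<dots>, X\<^sub>t\<close>. Hence every \<open>F\<^sub>t\<^sub>+\<^sub>1\<close>-measurable \<open>V\<close> has the form
  \<open>Z \<bullet> X\<^sub>t\<^sub>+\<^sub>1\<close> with \<open>Z\<close> measurable at time \<open>t\<close>, and one step of the equation, from the
  value \<open>V\<close> at time \<open>t + 1\<close> to \<open>Y\<close> at time \<open>t\<close>, can be solved explicitly. By the balance
  condition this step is a contraction of \<open>L\<^sup>\<infinity>\<close> with factor \<open>1 / (1 + \<alpha>)\<close> that preserves
  the ball of radius \<open>C / \<alpha>\<close>. Uniqueness, the convergence of the finite horizon solutions to a
  solution on the infinite horizon, and the rate of that convergence all follow by iteration.
\<close>

section \<open>Histories and the completed filtration\<close>

context basis_process
begin

text \<open>Padding with 0 after time \<open>t\<close> keeps one type for all \<open>t\<close>,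
  while equality of histories still means agreement of the paths up to \<open>t\<close>.\<close>

definition history :: "nat \<Rightarrow> 'a \<Rightarrow> nat \<Rightarrow> real^'n" where
  "history t \<omega> = (\<lambda>s. if s \<le> t then X s \<omega> else 0)"

lemma history_Suc: "history (Suc t) \<omega> = (history t \<omega>)(Suc t := X (Suc t) \<omega>)"
  by (auto simp: history_def fun_eq_iff le_Suc_eq)

lemma history_eq_iff: "history t \<omega> = history t \<omega>' \<longleftrightarrow> (\<forall>s\<le>t. X s \<omega> = X s \<omega>')"
  by (auto simp: history_def fun_eq_iff)

text \<open>Each of the \<open>t + 1\<close> states is one of finitely many basis vectors. This
  finiteness later gives measurability, boundedness and a case distinction over atoms.\<close>

lemma finite_range_history: "finite (history t ` space M)"
proof (rule finite_subset)
  let ?B = "range (\<lambda>i. axis i 1 :: real^'n)"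
  show "history t ` space M \<subseteq> (\<lambda>g s. if s \<le> t then g s else 0) ` ({..t} \<rightarrow>\<^sub>E ?B)"
  proof
    fix p assume "p \<in> history t ` space M"
    then obtain \<omega> where \<omega>: "\<omega> \<in> space M" "p = history t \<omega>" by auto
    have "p = (\<lambda>s. if s \<le> t then restrict (\<lambda>s. X s \<omega>) {..t} s else 0)"
      by (auto simp: \<omega> history_def fun_eq_iff)
    moreover have "restrict (\<lambda>s. X s \<omega>) {..t} \<in> {..t} \<rightarrow>\<^sub>E ?B"
      by (intro restrict_PiE_iff[THEN iffD2] ballI X_in_basis \<omega>)
    ultimately show "p \<in> (\<lambda>g s. if s \<le> t then g s else 0) ` ({..t} \<rightarrow>\<^sub>E ?B)" by blast
  qed
  show "finite ((\<lambda>g s. if s \<le> t then g s else 0) ` ({..t} \<rightarrow>\<^sub>E ?B))"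
    by (intro finite_imageI finite_PiE) auto
qed

lemma subalgebra_natural_algebra: "subalgebra M (natural_algebra M X t)"
proof -
  have "sigma_sets (space M) {X s -` A \<inter> space M | s A. s \<le> t \<and> A \<in> sets borel} \<subseteq> sets M"
    using measurable_sets[OF random_variable_X] by (intro sets.sigma_sets_subset) auto
  then show ?thesis
    unfolding subalgebra_def natural_algebra_def
    by (subst sets_measure_of) (auto simp: space_measure_of_conv)
qed

lemma space_filt [simp]: "space (filt M X t) = space M"
  by (simp add: filt_def space_restr_to_subalg)

text \<open>The null sets added by completion are events of \<open>M\<close> because
  \<open>M\<close> is generated by the completed algebras.\<close>

lemma subalgebra_filt: "subalgebra M (filt M X t)"
proof -
  have "sets (filt M X t) \<subseteq> sets M"
    unfolding sets_eq_generated by (auto intro: sigma_sets.Basic)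
  then show ?thesis by (simp add: subalgebra_def)
qed

lemma measurable_filt_imp_measurable:
  "g \<in> measurable (filt M X t) N \<Longrightarrow> g \<in> measurable M N"
  by (rule measurable_from_subalg[OF subalgebra_filt])

lemma sets_natural_algebra_subset: "sets (natural_algebra M X t) \<subseteq> sets (filt M X t)"
  unfolding filt_def using subalgebra_natural_algebra
  by (auto simp: sets_restr_to_subalg)

text \<open>The generators cannot separate points with equal history, and this property survives
  complements and countable unions.\<close>

lemma sets_natural_algebra_history_invariant:
  assumes "A \<in> sets (natural_algebra M X t)" "\<omega> \<in> space M" "\<omega>' \<in> space M"
    and "history t \<omega> = history t \<omega>'"
  shows "\<omega> \<in> A \<longleftrightarrow> \<omega>' \<in> A"
proof -
  have "A \<in> sigma_sets (space M) {X s -` A \<inter> space M | s A. s \<le> t \<and> A \<in> sets borel}"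
    using assms(1) unfolding natural_algebra_def by (subst (asm) sets_measure_of) auto
  then show ?thesis
    by induction (use assms in \<open>auto simp: history_eq_iff\<close>)
qed

lemma history_set_measurable:
  "{\<omega> \<in> space M. history t \<omega> = p} \<in> sets (filt M X t)"
proof -
  have *: "X s -` {p s} \<inter> space M \<in> sets (natural_algebra M X t)" if "s \<le> t" for s
  proof -
    have "{p s} \<in> sets borel" by simp
    with that show ?thesis
      unfolding natural_algebra_def
      by (subst sets_measure_of) (blast intro: sigma_sets.Basic)+
  qed
  show ?thesis
  proof (cases "\<forall>s>t. p s = 0")
    case True
    then have "{\<omega> \<in> space M. history t \<omega> = p} = (\<Inter>s\<in>{..t}. X s -` {p s} \<inter> space M)"
      by (auto simp: history_def fun_eq_iff)
    also have "\<dots> \<in> sets (natural_algebra M X t)"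
      using * by (intro sets.finite_INT) auto
    finally show ?thesis using sets_natural_algebra_subset by blast
  \<comment> \<open>A \<open>p\<close> that is nonzero somewhere after \<open>t\<close> violates the
    padding, so it is the history of no point.\<close>
  next
    case False
    then have "{\<omega> \<in> space M. history t \<omega> = p} = {}"
      by (auto simp: history_def)
    then show ?thesis by (simp only: sets.empty_sets)
  qed
qed

text \<open>Any \<open>h\<close> will do: a preimage is a finite union of sets on which the history
  is constant.\<close>

lemma measurable_history_comp:
  fixes h :: "(nat \<Rightarrow> real^'n) \<Rightarrow> 'b::topological_space"
  shows "(\<lambda>\<omega>. h (history t \<omega>)) \<in> borel_measurable (filt M X t)"
proof (rule measurableI)
  fix A :: "'b set"
  have "(\<lambda>\<omega>. h (history t \<omega>)) -` A \<inter> space (filt M X t) =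
      (\<Union>p\<in>{p \<in> history t ` space M. h p \<in> A}. {\<omega> \<in> space M. history t \<omega> = p})"
    by auto
  also have "\<dots> \<in> sets (filt M X t)"
    by (intro sets.finite_UN history_set_measurable finite_subset[OF _ finite_range_history]) auto
  finally show "(\<lambda>\<omega>. h (history t \<omega>)) -` A \<inter> space (filt M X t) \<in> sets (filt M X t)" .
qed simp

text \<open>Converse of \<open>measurable_history_comp\<close> up to null sets: \<open>g\<close> has
  a version measurable for the uncompleted algebra, whose level sets cannot separate points with
  equal history.\<close>

lemma filt_measurable_eq_history_real:
  fixes g :: "'a \<Rightarrow> real"
  assumes "g \<in> borel_measurable (filt M X t)"
  shows "\<exists>h. AE \<omega> in M. g \<omega> = h (history t \<omega>)"
proof -
  obtain g' where g': "g' \<in> borel_measurable (restr_to_subalg M (natural_algebra M X t))"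
    and ae: "AE \<omega> in restr_to_subalg M (natural_algebra M X t). g \<omega> = g' \<omega>"
    using completion_ex_borel_measurable_real assms unfolding filt_def by blast
  have g'_nat: "g' \<in> borel_measurable (natural_algebra M X t)"
    using measurable_in_subalg'[OF subalgebra_natural_algebra] g' by blast
  have inv: "g' \<omega> = g' \<omega>'" if "\<omega> \<in> space M" "\<omega>' \<in> space M" "history t \<omega> = history t \<omega>'" for \<omega> \<omega>'
  proof -
    have "g' -` {g' \<omega>} \<inter> space (natural_algebra M X t) \<in> sets (natural_algebra M X t)"
      using g'_nat by (rule measurable_sets) simp
    moreover have "space (natural_algebra M X t) = space M"
      using subalgebra_natural_algebra by (simp add: subalgebra_def)
    ultimately have "g' -` {g' \<omega>} \<inter> space M \<in> sets (natural_algebra M X t)" by simp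
    from sets_natural_algebra_history_invariant[OF this that] that show ?thesis by auto
  qed
  \<comment> \<open>Evaluate at any representative of the history; the value at unattained
    \<open>p\<close> is irrelevant.\<close>
  define h where "h p = g' (SOME \<omega>. \<omega> \<in> space M \<and> history t \<omega> = p)" for p
  have "g' \<omega> = h (history t \<omega>)" if "\<omega> \<in> space M" for \<omega>
  proof -
    have "\<exists>\<omega>'. \<omega>' \<in> space M \<and> history t \<omega>' = history t \<omega>" using that by blast
    from someI_ex[OF this] show ?thesis
      unfolding h_def by (intro inv) (use that in auto)
  qed
  then have "AE \<omega> in M. g' \<omega> = h (history t \<omega>)" by (intro AE_I2)
  with AE_restr_to_subalg[OF subalgebra_natural_algebra ae]
  have "AE \<omega> in M. g \<omega> = h (history t \<omega>)" by eventually_elim simp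
  then show ?thesis by blast
qed

lemma filt_measurable_eq_history:
  fixes g :: "'a \<Rightarrow> real^'n"
  assumes "g \<in> borel_measurable (filt M X t)"
  shows "\<exists>h. AE \<omega> in M. g \<omega> = h (history t \<omega>)"
proof -
  have "\<exists>h. AE \<omega> in M. g \<omega> $ i = h (history t \<omega>)" for i
    using assms by (intro filt_measurable_eq_history_real)
      (auto intro: borel_measurable_continuous_on[OF continuous_on_component])
  then obtain h where "\<And>i. AE \<omega> in M. g \<omega> $ i = h i (history t \<omega>)" by metis
  then have "AE \<omega> in M. \<forall>i. g \<omega> $ i = h i (history t \<omega>)" by (simp add: AE_all_countable)
  then have "AE \<omega> in M. g \<omega> = (\<chi> i. h i (history t \<omega>))"
    by eventually_elim (simp add: vec_eq_iff)
  then show ?thesis by (intro exI[of _ "\<lambda>p. \<chi> i. h i p"])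
qed

lemma history_set_events [measurable]: "{\<omega> \<in> space M. history t \<omega> = p} \<in> sets M"
  using history_set_measurable subalgebra_filt by (auto simp: subalgebra_def)

text \<open>Finitely many histories occur, and those of probability zero together form a null set.
  Almost sure claims can thus be checked one atom at a time.\<close>

lemma AE_histories:
  assumes "\<And>p. measure M {\<omega> \<in> space M. history t \<omega> = p} > 0 \<Longrightarrow>
    AE \<omega> in M. history t \<omega> = p \<longrightarrow> P \<omega>"
  shows "AE \<omega> in M. P \<omega>"
proof -
  have "AE \<omega> in M. history t \<omega> = p \<longrightarrow> P \<omega>" for p
  proof (cases "measure M {\<omega> \<in> space M. history t \<omega> = p} > 0")
    case False
    have "{\<omega> \<in> space M. history t \<omega> = p} \<in> null_sets M"
      using False by (auto simp: null_sets_def emeasure_eq_measure zero_less_measure_iff)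
    from AE_not_in[OF this] AE_space show ?thesis by eventually_elim auto
  qed (rule assms)
  then have "AE \<omega> in M. \<forall>p\<in>history t ` space M. history t \<omega> = p \<longrightarrow> P \<omega>"
    by (intro AE_finite_allI finite_range_history)
  with AE_space show ?thesis by eventually_elim auto
qed

text \<open>Given the past, \<open>V\<close> depends only on which basis vector comes next. Its
  value for the \<open>i\<close>-th one is stored as coordinate \<open>i\<close> of
  \<open>Z\<close>, and the inner product with \<open>X (Suc t)\<close> selects it.\<close>

lemma adapted_eq_inner_next:
  assumes "V \<in> borel_measurable (filt M X (Suc t))"
  shows "\<exists>Z\<in>borel_measurable (filt M X t). AE \<omega> in M. (V \<omega> :: real) = Z \<omega> \<bullet> X (Suc t) \<omega>"
proof -
  obtain h where h: "AE \<omega> in M. V \<omega> = h (history (Suc t) \<omega>)"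
    using filt_measurable_eq_history_real[OF assms] by blast
  let ?h' = "\<lambda>p. (\<chi> i. h (p(Suc t := axis i 1))) :: real^'n"
  have "AE \<omega> in M. V \<omega> = ?h' (history t \<omega>) \<bullet> X (Suc t) \<omega>"
    using h AE_space
  proof eventually_elim
    case (elim \<omega>)
    then obtain i where "X (Suc t) \<omega> = axis i 1" using X_in_basis by blast
    with elim show ?case by (simp add: history_Suc inner_axis)
  qed
  then show ?thesis using measurable_history_comp by (intro bexI)
qed

section \<open>Conditional means and martingale increments\<close>

lemma borel_measurable_vec_cond_exp [measurable]:
  "vec_cond_exp M (filt M X t) V \<in> borel_measurable (filt M X t)"
proof -
  have *: "vec_cond_exp M (filt M X t) V =
      (\<lambda>\<omega>. \<Sum>i\<in>UNIV. real_cond_exp M (filt M X t) (\<lambda>w. V w $ i) \<omega> *\<^sub>R axis i 1)"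
    by (auto simp: vec_cond_exp_def vec_eq_iff fun_eq_iff axis_def if_distrib
        cong: if_cong)
  show ?thesis unfolding * by measurable
qed

lemma sigma_finite_subalgebra_filt: "sigma_finite_subalgebra M (filt M X t)"
  by (intro finite_measure_subalgebra_is_sigma_finite finite_measure_subalgebra.intro
      finite_measure_axioms finite_measure_subalgebra_axioms.intro subalgebra_filt)

text \<open>The known factor is pulled out in each coordinate. The integrability this requires holds
  because \<open>D\<close> is almost surely a function of finitely many histories, hence
  bounded.\<close>

lemma cond_exp_inner_next:
  assumes D: "D \<in> borel_measurable (filt M X t)"
  shows "AE \<omega> in M. real_cond_exp M (filt M X t) (\<lambda>w. D w \<bullet> X (Suc t) w) \<omega>
    = D \<omega> \<bullet> vec_cond_exp M (filt M X t) (X (Suc t)) \<omega>"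
proof -
  interpret G: sigma_finite_subalgebra M "filt M X t" by (rule sigma_finite_subalgebra_filt)
  obtain h where h: "AE \<omega> in M. D \<omega> = h (history t \<omega>)"
    using filt_measurable_eq_history[OF D] by blast
  obtain B where B: "\<And>p. p \<in> history t ` space M \<Longrightarrow> norm (h p) \<le> B"
    using finite_imp_bounded[OF finite_imageI[OF finite_range_history], of h t]
    by (auto simp: bounded_iff)
  have XM [measurable]: "X s \<in> borel_measurable M" for s by (rule random_variable_X)
  have [measurable]: "D \<in> borel_measurable M" by (rule measurable_filt_imp_measurable[OF D])
  have Xi: "(\<lambda>w. X (Suc t) w $ i) \<in> borel_measurable M" for i
    by (auto intro: borel_measurable_continuous_on[OF continuous_on_component XM])
  have Di: "(\<lambda>w. D w $ i) \<in> borel_measurable (filt M X t)" for i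
    by (auto intro: borel_measurable_continuous_on[OF continuous_on_component D])
  have int: "integrable M (\<lambda>w. D w $ i * X (Suc t) w $ i)" for i
  proof (rule integrable_const_bound)
    show "AE w in M. norm (D w $ i * X (Suc t) w $ i) \<le> B * 1"
      using h AE_space
    proof eventually_elim
      case (elim w)
      have "\<bar>D w $ i\<bar> \<le> B"
        using B[of "history t w"] elim component_le_norm_cart[of "D w" i] by auto
      moreover have "\<bar>X (Suc t) w $ i\<bar> \<le> 1"
        using X_in_basis[of w "Suc t"] elim by (auto simp: axis_def)
      ultimately show ?case unfolding real_norm_def abs_mult by (intro mult_mono) auto
    qed
    show "(\<lambda>w. D w $ i * X (Suc t) w $ i) \<in> borel_measurable M"
      using Xi measurable_filt_imp_measurable[OF Di] by measurable
  qed
  have "AE \<omega> in M. \<forall>i. real_cond_exp M (filt M X t) (\<lambda>w. D w $ i * X (Suc t) w $ i) \<omega>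
      = D \<omega> $ i * real_cond_exp M (filt M X t) (\<lambda>w. X (Suc t) w $ i) \<omega>"
    using G.real_cond_exp_mult[OF Di Xi int] by (simp add: AE_all_countable)
  moreover have "AE \<omega> in M.
      real_cond_exp M (filt M X t) (\<lambda>w. \<Sum>i\<in>UNIV. D w $ i * X (Suc t) w $ i) \<omega>
      = (\<Sum>i\<in>UNIV. real_cond_exp M (filt M X t) (\<lambda>w. D w $ i * X (Suc t) w $ i) \<omega>)"
    by (rule G.real_cond_exp_sum[OF int])
  ultimately show ?thesis
    by eventually_elim (simp add: inner_vec_def vec_cond_exp_def)
qed

text \<open>The increment has conditional mean zero, whereas \<open>m\<close> is its own conditional
  expectation. The proof conditions the rearranged identity, with \<open>D\<close> applied to the
  next state on the left and \<open>D\<close> applied to its conditional mean plus \<open>m\<close>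
  on the right.\<close>

lemma adapted_martingale_increment_zero:
  assumes D: "D \<in> borel_measurable (filt M X t)" and m: "m \<in> borel_measurable (filt M X t)"
    and eq: "AE \<omega> in M. (m \<omega> :: real) = D \<omega> \<bullet> mart_diff M X t \<omega>"
  shows "AE \<omega> in M. m \<omega> = 0"
proof -
  interpret G: sigma_finite_subalgebra M "filt M X t" by (rule sigma_finite_subalgebra_filt)
  let ?c = "vec_cond_exp M (filt M X t) (X (Suc t))"
  have [measurable]: "X s \<in> borel_measurable M" "D \<in> borel_measurable M" for s
    using random_variable_X measurable_filt_imp_measurable[OF D] by auto
  have g: "(\<lambda>\<omega>. D \<omega> \<bullet> ?c \<omega> + m \<omega>) \<in> borel_measurable (filt M X t)"
    using D m by measurable
  obtain h where h: "AE \<omega> in M. D \<omega> \<bullet> ?c \<omega> + m \<omega> = h (history t \<omega>)"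
    using filt_measurable_eq_history_real[OF g] by blast
  obtain B where B: "\<And>p. p \<in> history t ` space M \<Longrightarrow> norm (h p) \<le> B"
    using finite_imp_bounded[OF finite_imageI[OF finite_range_history], of h t]
    by (auto simp: bounded_iff)
  have int: "integrable M (\<lambda>\<omega>. D \<omega> \<bullet> ?c \<omega> + m \<omega>)"
  proof (rule integrable_const_bound)
    show "AE \<omega> in M. norm (D \<omega> \<bullet> ?c \<omega> + m \<omega>) \<le> B"
      using h AE_space by eventually_elim (use B in auto)
  qed (rule measurable_filt_imp_measurable[OF g])
  have "AE \<omega> in M. D \<omega> \<bullet> X (Suc t) \<omega> = D \<omega> \<bullet> ?c \<omega> + m \<omega>"
    using eq by eventually_elim (simp add: mart_diff_def inner_diff_right)
  from G.real_cond_exp_cong[OF this] have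
    "AE \<omega> in M. real_cond_exp M (filt M X t) (\<lambda>\<omega>. D \<omega> \<bullet> X (Suc t) \<omega>) \<omega> =
      real_cond_exp M (filt M X t) (\<lambda>\<omega>. D \<omega> \<bullet> ?c \<omega> + m \<omega>) \<omega>"
    using measurable_filt_imp_measurable[OF g] by simp
  with cond_exp_inner_next[OF D] G.real_cond_exp_F_meas[OF int g]
  show ?thesis by eventually_elim simp
qed

section \<open>Atoms, possible jumps and the balance condition\<close>

lemma ex_in_set_AE:
  assumes "AE \<omega> in M. P \<omega>" "measure M A > 0"
  shows "\<exists>\<omega>\<in>A. P \<omega>"
proof (rule ccontr)
  assume neg: "\<not> (\<exists>\<omega>\<in>A. P \<omega>)"
  have A: "A \<in> sets M" using assms(2) measure_notin_sets by fastforce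
  have "AE \<omega> in M. \<omega> \<notin> A" using assms(1) by eventually_elim (use neg in auto)
  then have "measure M A = 0"
    using AE_iff_null_sets[OF A] by (simp add: measure_eq_0_null_sets)
  with assms(2) show False by simp
qed

lemma atom_history_set:
  assumes "measure M {\<omega> \<in> space M. history t \<omega> = p} > 0"
  shows "atom M X t {\<omega> \<in> space M. history t \<omega> = p}"
proof -
  have "{\<omega> \<in> space M. history t \<omega> = p} \<noteq> {}"
    using assms by (metis measure_empty less_irrefl)
  \<comment> \<open>The path of any point in the set supplies the states that name the atom.\<close>
  then obtain \<omega>0 where "history t \<omega>0 = p" by blast
  then have "{\<omega> \<in> space M. history t \<omega> = p} = {\<omega> \<in> space M. \<forall>s\<le>t. X s \<omega> = X s \<omega>0}"
    by (auto simp: history_eq_iff)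
  then have "sym_diff {\<omega> \<in> space M. history t \<omega> = p}
      {\<omega> \<in> space M. \<forall>s\<le>t. X s \<omega> = X s \<omega>0} = {}"
    by blast
  then show ?thesis
    unfolding atom_def
    by (intro conjI history_set_measurable assms exI[of _ "\<lambda>s. X s \<omega>0"])
      (simp only: null_sets.empty_sets)
qed

lemma mem_possible_jumps_iff:
  assumes "measure M F > 0"
  shows "i \<in> possible_jumps M X t F \<longleftrightarrow>
    measure M {\<omega> \<in> space M. X (Suc t) \<omega> = axis i 1 \<and> \<omega> \<in> F} > 0"
proof -
  have "F \<in> sets M" using assms measure_notin_sets by fastforce
  then have "{\<omega> \<in> space M. \<omega> \<in> F} = F" using sets.sets_into_space by blast
  then show ?thesis
    using assms by (simp add: possible_jumps_def cond_prob_def zero_less_divide_iff)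
qed

text \<open>Otherwise \<open>F\<close> would be covered by finitely many null events. It makes the
  \<open>Min\<close> in \<open>min_jump\<close> a genuine minimum.\<close>

lemma possible_jumps_nonempty:
  assumes "measure M F > 0"
  shows "possible_jumps M X t F \<noteq> {}"
proof
  assume empty: "possible_jumps M X t F = {}"
  have F: "F \<in> sets M" using assms measure_notin_sets by fastforce
  have [measurable]: "X s \<in> borel_measurable M" for s by (rule random_variable_X)
  have "measure M F \<le> measure M (\<Union>i\<in>UNIV. {\<omega> \<in> space M. X (Suc t) \<omega> = axis i 1 \<and> \<omega> \<in> F})"
  proof (rule finite_measure_mono)
    show "F \<subseteq> (\<Union>i\<in>UNIV. {\<omega> \<in> space M. X (Suc t) \<omega> = axis i 1 \<and> \<omega> \<in> F})"
      using X_in_basis sets.sets_into_space[OF F] by fastforce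
  qed (use F in measurable)
  also have "\<dots> \<le> (\<Sum>i\<in>UNIV. measure M {\<omega> \<in> space M. X (Suc t) \<omega> = axis i 1 \<and> \<omega> \<in> F})"
    by (rule finite_measure_subadditive_finite) (use F in auto)
  also have "\<dots> \<le> 0"
    using empty mem_possible_jumps_iff[OF assms] by (intro sum_nonpos) (auto simp: not_less)
  finally show False using assms by simp
qed

text \<open>
  On an atom, everything except the next jump is constant, so a lower bound for the next-step
  value bounds the jump \<open>(Z - Z') \<bullet> (e\<^sub>i - c)\<close> for every possible \<open>i\<close>, which is what the
  balance condition compares the driver with.
\<close>

lemma balanced_driver_lower_bound:
  assumes "balanced_driver M X f"
    and m: "m \<in> borel_measurable (filt M X t)"
    and Z: "Z \<in> borel_measurable (filt M X t)"
    and Z': "Z' \<in> borel_measurable (filt M X t)"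
    and bound: "AE \<omega> in M. - K \<le> m \<omega> + (Z \<omega> - Z' \<omega>) \<bullet> mart_diff M X t \<omega>"
  shows "AE \<omega> in M. - K \<le> m \<omega> + (f \<omega> t (Z \<omega>) - f \<omega> t (Z' \<omega>))"
proof -
  let ?c = "vec_cond_exp M (filt M X t) (X (Suc t))"
  obtain hm where hm: "AE \<omega> in M. m \<omega> = hm (history t \<omega>)"
    using filt_measurable_eq_history_real[OF m] by blast
  obtain hZ where hZ: "AE \<omega> in M. Z \<omega> = hZ (history t \<omega>)"
    using filt_measurable_eq_history[OF Z] by blast
  obtain hZ' where hZ': "AE \<omega> in M. Z' \<omega> = hZ' (history t \<omega>)"
    using filt_measurable_eq_history[OF Z'] by blast
  obtain hc where hc: "AE \<omega> in M. ?c \<omega> = hc (history t \<omega>)"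
    using filt_measurable_eq_history[OF borel_measurable_vec_cond_exp] by blast
  show ?thesis
  proof (rule AE_histories)
    fix p
    define F where "F = {\<omega> \<in> space M. history t \<omega> = p}"
    assume "measure M {\<omega> \<in> space M. history t \<omega> = p} > 0"
    then have atom: "atom M X t F" and F: "measure M F > 0"
      using atom_history_set by (auto simp: F_def)
    have jump: "- K - hm p \<le> (hZ p - hZ' p) \<bullet> (axis i 1 - hc p)"
      if "i \<in> possible_jumps M X t F" for i
    proof -
      have "AE \<omega> in M. - K \<le> hm (history t \<omega>) + (hZ (history t \<omega>) - hZ' (history t \<omega>)) \<bullet>
          (X (Suc t) \<omega> - hc (history t \<omega>))"
        using bound hm hZ hZ' hc by eventually_elim (simp add: mart_diff_def)
      \<comment> \<open>Jump \<open>i\<close> has positive probability on \<open>F\<close>, so the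
        almost sure bound holds at some point where it occurs; there it is an inequality between
        constants of the atom.\<close>
      from ex_in_set_AE[OF this] that mem_possible_jumps_iff[OF F]
      obtain \<omega> where "\<omega> \<in> {\<omega> \<in> space M. X (Suc t) \<omega> = axis i 1 \<and> \<omega> \<in> F}"
        "- K \<le> hm (history t \<omega>) + (hZ (history t \<omega>) - hZ' (history t \<omega>)) \<bullet>
          (X (Suc t) \<omega> - hc (history t \<omega>))" by blast
      then show ?thesis by (simp add: F_def)
    qed
    have "AE \<omega> in M. \<omega> \<in> F \<longrightarrow>
        f \<omega> t (hZ p) - f \<omega> t (hZ' p) > min_jump M X t F (hZ p - hZ' p) \<omega> \<or>
        (min_jump M X t F (hZ p - hZ' p) \<omega> = 0 \<and>
         f \<omega> t (hZ p) - f \<omega> t (hZ' p) = min_jump M X t F (hZ p - hZ' p) \<omega>)"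
      using assms(1) atom unfolding balanced_driver_def by blast
    with hm hZ hZ' hc AE_space
    show "AE \<omega> in M. history t \<omega> = p \<longrightarrow> - K \<le> m \<omega> + (f \<omega> t (Z \<omega>) - f \<omega> t (Z' \<omega>))"
    proof eventually_elim
      case (elim \<omega>)
      show ?case
      proof
        assume hist: "history t \<omega> = p"
        have "- K - hm p \<le> min_jump M X t F (hZ p - hZ' p) \<omega>"
          unfolding min_jump_def using jump possible_jumps_nonempty[OF F] elim hist
          by (subst Min_ge_iff) auto
        \<comment> \<open>Either alternative of the balance condition makes the driver difference at
          least the minimal jump.\<close>
        with elim hist show "- K \<le> m \<omega> + (f \<omega> t (Z \<omega>) - f \<omega> t (Z' \<omega>))"
          by (auto simp: F_def)
      qed
    qed
  qed
qed

end

section \<open>Limits with geometric error bounds\<close>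

lemma geometric_Cauchy_tendsto:
  fixes a :: "nat \<Rightarrow> real"
  assumes "1 < q" and a: "\<And>k l. \<bar>a k - a (k + l)\<bar> \<le> K / q ^ k"
  shows "a \<longlonglongrightarrow> lim a" and "\<bar>a k - lim a\<bar> \<le> K / q ^ k"
proof -
  have "Cauchy a"
  proof (rule CauchyI')
    fix e :: real assume "0 < e"
    with LIMSEQ_divide_realpow_zero[OF \<open>1 < q\<close>, of K]
    obtain n0 where n0: "\<And>n. n \<ge> n0 \<Longrightarrow> norm (K / q ^ n - 0) < e"
      unfolding LIMSEQ_iff by blast
    have "dist (a m) (a n) < e" if "m \<ge> n0" "n > m" for m n
    proof -
      have "\<bar>a m - a n\<bar> \<le> K / q ^ m" using a[of m "n - m"] that by simp
      also have "\<dots> < e" using n0[of m] that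
        by (metis abs_ge_self diff_zero order.strict_trans1 real_norm_def)
      finally show ?thesis by (simp add: dist_real_def)
    qed
    then show "\<exists>n0. \<forall>m\<ge>n0. \<forall>n>m. dist (a m) (a n) < e" by blast
  qed
  then show lim: "a \<longlonglongrightarrow> lim a"
    by (simp add: Cauchy_convergent_iff convergent_LIMSEQ_iff)
  \<comment> \<open>With \<open>k\<close> fixed, the bound is kept as \<open>l\<close> tends to
    infinity.\<close>
  have "(\<lambda>l. \<bar>a k - a (k + l)\<bar>) \<longlonglongrightarrow> \<bar>a k - lim a\<bar>"
    using LIMSEQ_ignore_initial_segment[OF lim, of k]
    by (intro tendsto_intros) (simp add: add.commute)
  then show "\<bar>a k - lim a\<bar> \<le> K / q ^ k"
    using a by (intro LIMSEQ_le_const2) auto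
qed

lemma AE_zero_if_geometric_bound:
  fixes g :: "'a \<Rightarrow> real"
  assumes "1 < q" "\<And>k. AE \<omega> in M. \<bar>g \<omega>\<bar> \<le> K / q ^ k"
  shows "AE \<omega> in M. g \<omega> = 0"
proof -
  have "AE \<omega> in M. \<forall>k. \<bar>g \<omega>\<bar> \<le> K / q ^ k"
    using assms(2) by (simp add: AE_all_countable)
  then show ?thesis
  proof eventually_elim
    case (elim \<omega>)
    have "\<bar>g \<omega>\<bar> \<le> 0"
      by (rule LIMSEQ_le_const[OF LIMSEQ_divide_realpow_zero[OF \<open>1 < q\<close>, of K]])
        (use elim in auto)
    then show ?case by simp
  qed
qed

section \<open>A single step of the discounted equation\<close>

locale discounted_bsde = basis_process M X
  for M :: "'a measure" and X :: "nat \<Rightarrow> 'a \<Rightarrow> real^'n" +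
  fixes f :: "'a \<Rightarrow> nat \<Rightarrow> real^'n \<Rightarrow> real" and \<alpha> :: real
  assumes adapted: "adapted_driver M X f"
    and balanced: "balanced_driver M X f"
    and discount_pos: "\<alpha> > 0"
begin

text \<open>This is the equation between times \<open>t\<close> and \<open>t + 1\<close>, with the
  later value \<open>V\<close> as datum and \<open>Y\<close>, \<open>Z\<close> as unknowns, so that
  solving proceeds backwards in time.\<close>

definition step ::
    "nat \<Rightarrow> ('a \<Rightarrow> real) \<Rightarrow> ('a \<Rightarrow> real) \<Rightarrow> ('a \<Rightarrow> real^'n) \<Rightarrow> bool" where
  "step t V Y Z \<longleftrightarrow>
     Y \<in> borel_measurable (filt M X t) \<and> Z \<in> borel_measurable (filt M X t) \<and>
     (AE \<omega> in M. V \<omega> = Y \<omega> - (f \<omega> t (Z \<omega>) - \<alpha> * Y \<omega>) + Z \<omega> \<bullet> mart_diff M X t \<omega>)"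

lemma driver_measurable:
  assumes "Z \<in> borel_measurable (filt M X t)"
  shows "(\<lambda>\<omega>. f \<omega> t (Z \<omega>)) \<in> borel_measurable (filt M X t)"
proof -
  have pair: "(\<lambda>\<omega>. (\<omega>, Z \<omega>)) \<in> measurable (filt M X t) (filt M X t \<Otimes>\<^sub>M borel)"
    using assms by measurable
  have f: "(\<lambda>(\<omega>, z). f \<omega> t z) \<in> borel_measurable (filt M X t \<Otimes>\<^sub>M borel)"
    using adapted by (simp add: adapted_driver_def)
  from measurable_compose[OF pair f] show ?thesis by simp
qed

text \<open>Represent \<open>V\<close> as \<open>Z\<close> applied to the next state, and split that
  state into conditional mean plus increment. The increments then match, and what remains is linear
  in \<open>Y\<close> with coefficient \<open>1 + \<alpha>\<close>, since the driver does not depend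
  on \<open>Y\<close>.\<close>

lemma step_exists:
  assumes "V \<in> borel_measurable (filt M X (Suc t))"
  shows "\<exists>Y Z. step t V Y Z"
proof -
  obtain Z where Z: "Z \<in> borel_measurable (filt M X t)"
    and V: "AE \<omega> in M. V \<omega> = Z \<omega> \<bullet> X (Suc t) \<omega>"
    using adapted_eq_inner_next[OF assms] by blast
  let ?Y = "\<lambda>\<omega>. (Z \<omega> \<bullet> vec_cond_exp M (filt M X t) (X (Suc t)) \<omega> + f \<omega> t (Z \<omega>)) / (1 + \<alpha>)"
  have Y_eq: "?Y \<omega> + \<alpha> * ?Y \<omega> = Z \<omega> \<bullet> vec_cond_exp M (filt M X t) (X (Suc t)) \<omega> + f \<omega> t (Z \<omega>)"
    for \<omega>
  proof -
    have "?Y \<omega> + \<alpha> * ?Y \<omega> = (1 + \<alpha>) * ?Y \<omega>" by (simp only: distrib_right mult_1_left)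
    then show ?thesis using discount_pos by simp
  qed
  have "step t V ?Y Z"
    unfolding step_def
  proof (intro conjI Z)
    show "?Y \<in> borel_measurable (filt M X t)"
      using Z driver_measurable[OF Z] by measurable
    show "AE \<omega> in M. V \<omega> = ?Y \<omega> - (f \<omega> t (Z \<omega>) - \<alpha> * ?Y \<omega>) + Z \<omega> \<bullet> mart_diff M X t \<omega>"
      using V
    proof eventually_elim
      case (elim \<omega>)
      then show ?case
        using Y_eq[of \<omega>] by (simp add: mart_diff_def inner_diff_right)
    qed
  qed
  then show ?thesis by blast
qed

text \<open>The upper bound is the lower one after negating \<open>m\<close> and exchanging
  \<open>Z\<close> and \<open>Z'\<close>. The effect is to trade the martingale increment for the
  driver difference without enlarging \<open>K\<close>.\<close>

lemma driver_comparison: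
  assumes m: "m \<in> borel_measurable (filt M X t)"
    and Z: "Z \<in> borel_measurable (filt M X t)"
    and Z': "Z' \<in> borel_measurable (filt M X t)"
    and bound: "AE \<omega> in M. \<bar>m \<omega> + (Z \<omega> - Z' \<omega>) \<bullet> mart_diff M X t \<omega>\<bar> \<le> K"
  shows "AE \<omega> in M. \<bar>m \<omega> + (f \<omega> t (Z \<omega>) - f \<omega> t (Z' \<omega>))\<bar> \<le> K"
proof -
  have "AE \<omega> in M. - K \<le> m \<omega> + (Z \<omega> - Z' \<omega>) \<bullet> mart_diff M X t \<omega>"
    using bound by eventually_elim simp
  from balanced_driver_lower_bound[OF balanced m Z Z' this]
  have lower: "AE \<omega> in M. - K \<le> m \<omega> + (f \<omega> t (Z \<omega>) - f \<omega> t (Z' \<omega>))" .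
  have "AE \<omega> in M. - K \<le> - m \<omega> + (Z' \<omega> - Z \<omega>) \<bullet> mart_diff M X t \<omega>"
    using bound
  proof eventually_elim
    case (elim \<omega>)
    then have "m \<omega> + (Z \<omega> - Z' \<omega>) \<bullet> mart_diff M X t \<omega> \<le> K" by simp
    then show ?case by (simp add: inner_diff_left)
  qed
  from balanced_driver_lower_bound[OF balanced _ Z' Z this] m
  have "AE \<omega> in M. - K \<le> - m \<omega> + (f \<omega> t (Z' \<omega>) - f \<omega> t (Z \<omega>))" by simp
  with lower show ?thesis by eventually_elim (simp add: abs_le_iff)
qed

text \<open>Choose \<open>m\<close> so that \<open>V - V'\<close> is \<open>m\<close> plus the
  martingale increment of \<open>Z - Z'\<close>. Trading that increment for the driver difference
  cancels the driver terms in \<open>m\<close> and leaves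
  \<open>(1 + \<alpha>) * (Y - Y')\<close>.\<close>

lemma step_contraction:
  assumes s: "step t V Y Z" and s': "step t V' Y' Z'"
    and K: "AE \<omega> in M. \<bar>V \<omega> - V' \<omega>\<bar> \<le> K"
  shows "AE \<omega> in M. \<bar>Y \<omega> - Y' \<omega>\<bar> \<le> K / (1 + \<alpha>)"
proof -
  define m where "m \<omega> = (1 + \<alpha>) * (Y \<omega> - Y' \<omega>) - (f \<omega> t (Z \<omega>) - f \<omega> t (Z' \<omega>))" for \<omega>
  have [measurable]: "Z \<in> borel_measurable (filt M X t)" "Z' \<in> borel_measurable (filt M X t)"
    "Y \<in> borel_measurable (filt M X t)" "Y' \<in> borel_measurable (filt M X t)"
    using s s' by (auto simp: step_def)
  note [measurable] = driver_measurable
  have "m \<in> borel_measurable (filt M X t)"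
    unfolding m_def by measurable
  moreover have "AE \<omega> in M. \<bar>m \<omega> + (Z \<omega> - Z' \<omega>) \<bullet> mart_diff M X t \<omega>\<bar> \<le> K"
    using K s[unfolded step_def, THEN conjunct2, THEN conjunct2]
      s'[unfolded step_def, THEN conjunct2, THEN conjunct2]
  proof eventually_elim
    case (elim \<omega>)
    have "m \<omega> + (Z \<omega> - Z' \<omega>) \<bullet> mart_diff M X t \<omega> = V \<omega> - V' \<omega>"
      by (simp add: m_def elim algebra_simps inner_diff_left)
    then show ?case using elim by simp
  qed
  ultimately have "AE \<omega> in M. \<bar>m \<omega> + (f \<omega> t (Z \<omega>) - f \<omega> t (Z' \<omega>))\<bar> \<le> K"
    by (intro driver_comparison) auto
  then show ?thesis
  proof eventually_elim
    case (elim \<omega>)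
    then have "\<bar>(1 + \<alpha>) * (Y \<omega> - Y' \<omega>)\<bar> \<le> K" by (simp add: m_def)
    then show ?case
      using discount_pos by (simp add: abs_mult pos_le_divide_eq mult.commute)
  qed
qed

text \<open>Comparison with \<open>Z' = 0\<close> bounds
  \<open>(1 + \<alpha>) * Y - f \<omega> t 0\<close> by \<open>C / \<alpha>\<close>. The radius is
  preserved because \<open>C / \<alpha> + C = (1 + \<alpha>) * (C / \<alpha>)\<close>.\<close>

lemma step_bound:
  assumes s: "step t V Y Z" and C: "AE \<omega> in M. \<bar>f \<omega> t 0\<bar> \<le> C"
    and V: "AE \<omega> in M. \<bar>V \<omega>\<bar> \<le> C / \<alpha>"
  shows "AE \<omega> in M. \<bar>Y \<omega>\<bar> \<le> C / \<alpha>"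
proof -
  define m where "m \<omega> = (1 + \<alpha>) * Y \<omega> - f \<omega> t (Z \<omega>)" for \<omega>
  have [measurable]: "Z \<in> borel_measurable (filt M X t)" "Y \<in> borel_measurable (filt M X t)"
    using s by (auto simp: step_def)
  note [measurable] = driver_measurable
  have "m \<in> borel_measurable (filt M X t)"
    unfolding m_def by measurable
  moreover have "AE \<omega> in M. \<bar>m \<omega> + (Z \<omega> - 0) \<bullet> mart_diff M X t \<omega>\<bar> \<le> C / \<alpha>"
    using V s[unfolded step_def, THEN conjunct2, THEN conjunct2]
    by eventually_elim (simp add: m_def algebra_simps)
  ultimately have "AE \<omega> in M. \<bar>m \<omega> + (f \<omega> t (Z \<omega>) - f \<omega> t 0)\<bar> \<le> C / \<alpha>"
    using driver_comparison[of m t Z "\<lambda>_. 0" "C / \<alpha>"] by simp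
  with C show ?thesis
  proof eventually_elim
    case (elim \<omega>)
    then have "\<bar>(1 + \<alpha>) * Y \<omega>\<bar> \<le> C / \<alpha> + C" by (simp add: m_def)
    also have "\<dots> = (1 + \<alpha>) * (C / \<alpha>)" using discount_pos by (simp add: field_simps)
    finally have "(1 + \<alpha>) * \<bar>Y \<omega>\<bar> \<le> (1 + \<alpha>) * (C / \<alpha>)"
      using discount_pos by (simp only: abs_mult)
    then show ?case using discount_pos by (subst (asm) mult_le_cancel_left_pos) auto
  qed
qed

text \<open>Contraction with bound 0 identifies \<open>Y\<close>. Subtracting the equations then
  equates the driver difference, known at time \<open>t\<close>, with a martingale increment, so
  both vanish and \<open>Z - Z'\<close> has seminorm zero.\<close>

lemma step_unique:
  assumes s: "step t V Y Z" and s': "step t V' Y' Z'" and V: "AE \<omega> in M. V \<omega> = V' \<omega>"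
  shows "AE \<omega> in M. Y \<omega> = Y' \<omega>" and "M_equiv_at M X t Z Z'"
proof -
  have "AE \<omega> in M. \<bar>V \<omega> - V' \<omega>\<bar> \<le> 0" using V by eventually_elim simp
  from step_contraction[OF s s' this] show Y: "AE \<omega> in M. Y \<omega> = Y' \<omega>"
    by eventually_elim simp
  have Z [measurable]: "Z \<in> borel_measurable (filt M X t)" "Z' \<in> borel_measurable (filt M X t)"
    using s s' by (auto simp: step_def)
  note [measurable] = driver_measurable
  have eq: "AE \<omega> in M. f \<omega> t (Z \<omega>) - f \<omega> t (Z' \<omega>) = (Z \<omega> - Z' \<omega>) \<bullet> mart_diff M X t \<omega>"
    using V Y s[unfolded step_def, THEN conjunct2, THEN conjunct2]
      s'[unfolded step_def, THEN conjunct2, THEN conjunct2]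
    by eventually_elim (simp add: inner_diff_left)
  have "AE \<omega> in M. f \<omega> t (Z \<omega>) - f \<omega> t (Z' \<omega>) = 0"
    by (rule adapted_martingale_increment_zero[OF _ _ eq]) measurable
  with eq have zero: "AE \<omega> in M. ((Z \<omega> - Z' \<omega>) \<bullet> mart_diff M X t \<omega>)\<^sup>2 = 0"
    by eventually_elim simp
  interpret G: sigma_finite_subalgebra M "filt M X t" by (rule sigma_finite_subalgebra_filt)
  have [measurable]: "X (Suc t) \<in> borel_measurable M"
    "vec_cond_exp M (filt M X t) (X (Suc t)) \<in> borel_measurable M"
    "Z \<in> borel_measurable M" "Z' \<in> borel_measurable M"
    using random_variable_X Z[THEN measurable_filt_imp_measurable]
      borel_measurable_vec_cond_exp[THEN measurable_filt_imp_measurable] by auto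
  have "AE \<omega> in M. real_cond_exp M (filt M X t)
      (\<lambda>w. ((Z w - Z' w) \<bullet> mart_diff M X t w)\<^sup>2) \<omega> = real_cond_exp M (filt M X t) (\<lambda>_. 0) \<omega>"
    unfolding mart_diff_def
    by (rule G.real_cond_exp_cong[OF zero[unfolded mart_diff_def]]) measurable
  moreover have "AE \<omega> in M. real_cond_exp M (filt M X t) (\<lambda>_. 0) \<omega> = 0"
    by (rule G.real_cond_exp_F_meas) auto
  ultimately show "M_equiv_at M X t Z Z'"
    unfolding M_equiv_at_def mart_norm_def by eventually_elim simp
qed

section \<open>Iterating the step over a time interval\<close>

lemma steps_contraction:
  assumes "t \<le> T"
    and "\<And>u. t \<le> u \<Longrightarrow> u < T \<Longrightarrow> step u (Y (Suc u)) (Y u) (Z u)"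
    and "\<And>u. t \<le> u \<Longrightarrow> u < T \<Longrightarrow> step u (Y' (Suc u)) (Y' u) (Z' u)"
    and "AE \<omega> in M. \<bar>Y T \<omega> - Y' T \<omega>\<bar> \<le> K"
  shows "AE \<omega> in M. \<bar>Y t \<omega> - Y' t \<omega>\<bar> \<le> K / (1 + \<alpha>) ^ (T - t)"
  using assms
proof (induction rule: inc_induct)
  case (step n)
  have "AE \<omega> in M. \<bar>Y (Suc n) \<omega> - Y' (Suc n) \<omega>\<bar> \<le> K / (1 + \<alpha>) ^ (T - Suc n)"
    using step by auto
  from step_contraction[OF step.prems(1)[of n] step.prems(2)[of n] this] step.hyps
  have "AE \<omega> in M. \<bar>Y n \<omega> - Y' n \<omega>\<bar> \<le> K / (1 + \<alpha>) ^ (T - Suc n) / (1 + \<alpha>)"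
    by simp
  moreover have "(1 + \<alpha>) ^ (T - n) = (1 + \<alpha>) ^ (T - Suc n) * (1 + \<alpha>)"
    using step.hyps by (metis Suc_diff_Suc mult.commute power_Suc)
  ultimately show ?case by simp
qed simp

lemma steps_bound:
  assumes C: "\<And>t. AE \<omega> in M. \<bar>f \<omega> t 0\<bar> \<le> C"
    and "t \<le> T"
    and "\<And>u. t \<le> u \<Longrightarrow> u < T \<Longrightarrow> step u (Y (Suc u)) (Y u) (Z u)"
    and "AE \<omega> in M. \<bar>Y T \<omega>\<bar> \<le> C / \<alpha>"
  shows "AE \<omega> in M. \<bar>Y t \<omega>\<bar> \<le> C / \<alpha>"
  using assms(2-)
proof (induction rule: inc_induct)
  case (step n)
  then show ?case using step_bound[OF _ C, of n] by (meson Suc_leD order.refl)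
qed

section \<open>Summed equations as chains of steps\<close>

lemma steps_telescope:
  assumes "t \<le> T" "\<And>u. t \<le> u \<Longrightarrow> u < T \<Longrightarrow> step u (Y (Suc u)) (Y u) (Z u)"
  shows "AE \<omega> in M. Y T \<omega> = Y t \<omega> - (\<Sum>u\<in>{t..<T}. f \<omega> u (Z u \<omega>) - \<alpha> * Y u \<omega>)
    + (\<Sum>u\<in>{t..<T}. Z u \<omega> \<bullet> mart_diff M X u \<omega>)"
  using assms
proof (induction rule: dec_induct)
  case (step n)
  have "AE \<omega> in M. Y n \<omega> = Y t \<omega> - (\<Sum>u\<in>{t..<n}. f \<omega> u (Z u \<omega>) - \<alpha> * Y u \<omega>)
    + (\<Sum>u\<in>{t..<n}. Z u \<omega> \<bullet> mart_diff M X u \<omega>)"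
    using step by auto
  with step.prems[of n, OF step.hyps(1) lessI, unfolded step_def, THEN conjunct2, THEN conjunct2]
  show ?case
  proof eventually_elim
    case (elim \<omega>)
    show ?case
      unfolding sum.atLeastLessThan_Suc[OF \<open>t \<le> n\<close>] elim(1) using elim(2) by linarith
  qed
qed simp

text \<open>Taking \<open>T = Suc t\<close> isolates a step, and telescoping recovers the sums. From
  here on solutions are handled as chains of steps.\<close>

lemma bsde_infinite_iff:
  "bsde_infinite M X f \<alpha> Y Z \<longleftrightarrow> (\<forall>t. step t (Y (Suc t)) (Y t) (Z t))"
proof
  assume inf: "bsde_infinite M X f \<alpha> Y Z"
  then have "AE \<omega> in M. Y (Suc t) \<omega> = Y t \<omega> - (\<Sum>u\<in>{t..<Suc t}. f \<omega> u (Z u \<omega>) - \<alpha> * Y u \<omega>)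
      + (\<Sum>u\<in>{t..<Suc t}. Z u \<omega> \<bullet> mart_diff M X u \<omega>)" for t
    unfolding bsde_infinite_def by blast
  with inf show "\<forall>t. step t (Y (Suc t)) (Y t) (Z t)"
    by (simp add: step_def bsde_infinite_def)
next
  assume step: "\<forall>t. step t (Y (Suc t)) (Y t) (Z t)"
  then have "AE \<omega> in M. Y T \<omega> = Y t \<omega> - (\<Sum>u\<in>{t..<T}. f \<omega> u (Z u \<omega>) - \<alpha> * Y u \<omega>)
      + (\<Sum>u\<in>{t..<T}. Z u \<omega> \<bullet> mart_diff M X u \<omega>)" if "t < T" for t T
    using that by (intro steps_telescope) auto
  with step show "bsde_infinite M X f \<alpha> Y Z"
    unfolding bsde_infinite_def step_def by blast
qed

text \<open>At \<open>t = T\<close> the sums are empty, which gives the terminal value; comparing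
  the equations at \<open>t\<close> and \<open>Suc t\<close> isolates a step. Measurability at
  \<open>T\<close> is listed separately because no step starts there.\<close>

lemma bsde_finite_iff:
  "bsde_finite M X f \<alpha> T Y Z \<longleftrightarrow>
     Y T \<in> borel_measurable (filt M X T) \<and> (AE \<omega> in M. Y T \<omega> = 0) \<and>
     (\<forall>t<T. step t (Y (Suc t)) (Y t) (Z t))"
proof
  assume fin: "bsde_finite M X f \<alpha> T Y Z"
  then have eq: "AE \<omega> in M. 0 = Y t \<omega> - (\<Sum>u\<in>{t..<T}. f \<omega> u (Z u \<omega>) - \<alpha> * Y u \<omega>)
      + (\<Sum>u\<in>{t..<T}. Z u \<omega> \<bullet> mart_diff M X u \<omega>)" if "t \<le> T" for t
    using that unfolding bsde_finite_def by blast
  have "step t (Y (Suc t)) (Y t) (Z t)" if "t < T" for t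
    unfolding step_def
  proof (intro conjI)
    have "Suc t \<le> T" "t \<le> T" using that by auto
    from eq[OF this(1)] eq[OF this(2)]
    show "AE \<omega> in M. Y (Suc t) \<omega> =
        Y t \<omega> - (f \<omega> t (Z t \<omega>) - \<alpha> * Y t \<omega>) + Z t \<omega> \<bullet> mart_diff M X t \<omega>"
      by eventually_elim (use that in \<open>simp add: sum.atLeast_Suc_lessThan\<close>)
  qed (use fin that in \<open>auto simp: bsde_finite_def\<close>)
  then show "Y T \<in> borel_measurable (filt M X T) \<and> (AE \<omega> in M. Y T \<omega> = 0) \<and>
      (\<forall>t<T. step t (Y (Suc t)) (Y t) (Z t))"
    using fin eq[OF order.refl] by (auto simp: bsde_finite_def)
next
  assume step: "Y T \<in> borel_measurable (filt M X T) \<and> (AE \<omega> in M. Y T \<omega> = 0) \<and>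
      (\<forall>t<T. step t (Y (Suc t)) (Y t) (Z t))"
  show "bsde_finite M X f \<alpha> T Y Z"
    unfolding bsde_finite_def
  proof (intro conjI allI impI)
    fix t assume "t \<le> T"
    then show "Y t \<in> borel_measurable (filt M X t)"
      using step by (cases "t = T") (auto simp: step_def)
    have "AE \<omega> in M. Y T \<omega> = Y t \<omega> - (\<Sum>u\<in>{t..<T}. f \<omega> u (Z u \<omega>) - \<alpha> * Y u \<omega>)
        + (\<Sum>u\<in>{t..<T}. Z u \<omega> \<bullet> mart_diff M X u \<omega>)"
      using step \<open>t \<le> T\<close> by (intro steps_telescope) auto
    with step[THEN conjunct2, THEN conjunct1]
    show "AE \<omega> in M. 0 = Y t \<omega> - (\<Sum>u\<in>{t..<T}. f \<omega> u (Z u \<omega>) - \<alpha> * Y u \<omega>)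
        + (\<Sum>u\<in>{t..<T}. Z u \<omega> \<bullet> mart_diff M X u \<omega>)"
      by eventually_elim simp
  qed (use step in \<open>auto simp: step_def\<close>)
qed

section \<open>Finite horizon: existence and uniqueness\<close>

lemma bsde_finite_exists: "\<exists>Y Z. bsde_finite M X f \<alpha> T Y Z"
proof -
  \<comment> \<open>Backward induction. Measurability of \<open>Y t\<close> is carried along because
    the next step back needs it, and updating at the new time leaves later steps untouched.\<close>
  have "\<exists>Y Z. Y T = (\<lambda>_. 0) \<and> Y t \<in> borel_measurable (filt M X t) \<and>
      (\<forall>u. t \<le> u \<and> u < T \<longrightarrow> step u (Y (Suc u)) (Y u) (Z u))" if "t \<le> T" for t
    using that
  proof (induction rule: inc_induct)
    case base
    show ?case by (intro exI[of _ "\<lambda>_ _. 0"]) auto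
  next
    case (step n)
    then obtain Y Z where Y: "Y T = (\<lambda>_. 0)" "Y (Suc n) \<in> borel_measurable (filt M X (Suc n))"
      and YZ: "\<forall>u. Suc n \<le> u \<and> u < T \<longrightarrow> step u (Y (Suc u)) (Y u) (Z u)" by blast
    obtain y z where yz: "step n (Y (Suc n)) y z" using step_exists[OF Y(2)] by blast
    have "step u ((Y(n := y)) (Suc u)) ((Y(n := y)) u) ((Z(n := z)) u)"
      if "n \<le> u" "u < T" for u
      using yz YZ that by (cases "u = n") auto
    moreover have "y \<in> borel_measurable (filt M X n)" using yz by (simp add: step_def)
    ultimately show ?case
      using Y(1) step.hyps by (intro exI[of _ "Y(n := y)"] exI[of _ "Z(n := z)"]) auto
  qed
  from this[of 0] obtain Y Z where "Y T = (\<lambda>_. 0)" "\<And>u. u < T \<Longrightarrow> step u (Y (Suc u)) (Y u) (Z u)"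
    by auto
  then have "bsde_finite M X f \<alpha> T Y Z" by (simp add: bsde_finite_iff)
  then show ?thesis by blast
qed

lemma steps_unique:
  assumes "\<And>u. u < T \<Longrightarrow> step u (Y (Suc u)) (Y u) (Z u)"
    and "\<And>u. u < T \<Longrightarrow> step u (Y' (Suc u)) (Y' u) (Z' u)"
    and "AE \<omega> in M. Y T \<omega> = Y' T \<omega>" and "t \<le> T"
  shows "AE \<omega> in M. Y t \<omega> = Y' t \<omega>"
proof -
  have "AE \<omega> in M. \<bar>Y T \<omega> - Y' T \<omega>\<bar> \<le> 0" using assms(3) by eventually_elim simp
  with assms have "AE \<omega> in M. \<bar>Y t \<omega> - Y' t \<omega>\<bar> \<le> 0 / (1 + \<alpha>) ^ (T - t)"
    by (intro steps_contraction) auto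
  then show ?thesis by eventually_elim simp
qed

lemma bsde_finite_unique:
  assumes "bsde_finite M X f \<alpha> T Y Z" "bsde_finite M X f \<alpha> T Y' Z'"
  shows "AE \<omega> in M. \<forall>t\<le>T. Y t \<omega> = Y' t \<omega>" and "\<forall>t<T. M_equiv_at M X t (Z t) (Z' t)"
proof -
  note sol = assms[unfolded bsde_finite_iff]
  have "AE \<omega> in M. Y T \<omega> = Y' T \<omega>"
    using sol(1)[THEN conjunct2, THEN conjunct1] sol(2)[THEN conjunct2, THEN conjunct1]
    by eventually_elim simp
  with sol have eq: "AE \<omega> in M. Y t \<omega> = Y' t \<omega>" if "t \<le> T" for t
    using that by - (rule steps_unique[of T Y Z Y' Z'], auto)
  then have "AE \<omega> in M. t \<le> T \<longrightarrow> Y t \<omega> = Y' t \<omega>" for t by (cases "t \<le> T") auto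
  then show "AE \<omega> in M. \<forall>t\<le>T. Y t \<omega> = Y' t \<omega>" by (simp add: AE_all_countable)
  show "\<forall>t<T. M_equiv_at M X t (Z t) (Z' t)"
  proof (intro allI impI)
    fix t assume "t < T"
    \<comment> \<open>Uniqueness of \<open>Z t\<close> rests on equality of the values at
      \<open>Suc t\<close>, which must lie within the horizon.\<close>
    then have "Suc t \<le> T" by simp
    show "M_equiv_at M X t (Z t) (Z' t)"
      using sol(1)[THEN conjunct2, THEN conjunct2, rule_format, OF \<open>t < T\<close>]
        sol(2)[THEN conjunct2, THEN conjunct2, rule_format, OF \<open>t < T\<close>] eq[OF \<open>Suc t \<le> T\<close>]
      by (rule step_unique(2))
  qed
qed

section \<open>Infinite horizon: uniqueness, existence and approximation\<close>

lemma bsde_infinite_unique: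
  assumes sol: "bsde_infinite M X f \<alpha> Y Z" "bsde_infinite M X f \<alpha> Y' Z'"
    and "bounded_process M Y" "bounded_process M Y'"
  shows "AE \<omega> in M. \<forall>t. Y t \<omega> = Y' t \<omega>" and "M_equiv_at M X t (Z t) (Z' t)"
proof -
  obtain K K' where K: "\<And>t. AE \<omega> in M. \<bar>Y t \<omega>\<bar> \<le> K" and K': "\<And>t. AE \<omega> in M. \<bar>Y' t \<omega>\<bar> \<le> K'"
    using assms(3,4) by (auto simp: bounded_process_def)
  have diff: "AE \<omega> in M. \<bar>Y t \<omega> - Y' t \<omega>\<bar> \<le> K + K'" for t
    using K[of t] K'[of t] by eventually_elim simp
  have eq: "AE \<omega> in M. Y t \<omega> = Y' t \<omega>" for t
  proof -
    \<comment> \<open>Any later time \<open>t + k\<close> may serve as terminal time, with the same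
      bound on the difference there.\<close>
    have "AE \<omega> in M. \<bar>Y t \<omega> - Y' t \<omega>\<bar> \<le> (K + K') / (1 + \<alpha>) ^ k" for k
      using steps_contraction[of t "t + k" Y Z Y' Z', OF _ _ _ diff] sol
      by (simp add: bsde_infinite_iff)
    then have "AE \<omega> in M. Y t \<omega> - Y' t \<omega> = 0"
      using discount_pos by (intro AE_zero_if_geometric_bound[of "1 + \<alpha>"]) auto
    then show ?thesis by eventually_elim simp
  qed
  then show "AE \<omega> in M. \<forall>t. Y t \<omega> = Y' t \<omega>" by (simp add: AE_all_countable)
  show "M_equiv_at M X t (Z t) (Z' t)"
    using sol[unfolded bsde_infinite_iff, rule_format, of t] eq[of "Suc t"]
    by (rule step_unique(2))
qed

text \<open>The terminal difference is just \<open>Y' T\<close>. The chain \<open>Y'\<close> may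
  come from a longer finite horizon or from the infinite one, and both uses occur below.\<close>

lemma bsde_finite_infinite_diff:
  assumes "bsde_finite M X f \<alpha> T Y Z" "\<And>t. t < T \<Longrightarrow> step t (Y' (Suc t)) (Y' t) (Z' t)"
    and "AE \<omega> in M. \<bar>Y' T \<omega>\<bar> \<le> K" and "t \<le> T"
  shows "AE \<omega> in M. \<bar>Y t \<omega> - Y' t \<omega>\<bar> \<le> K / (1 + \<alpha>) ^ (T - t)"
proof (rule steps_contraction)
  show "AE \<omega> in M. \<bar>Y T \<omega> - Y' T \<omega>\<bar> \<le> K"
    using assms(1)[unfolded bsde_finite_iff, THEN conjunct2, THEN conjunct1] assms(3)
    by eventually_elim simp
  show "step u (Y (Suc u)) (Y u) (Z u)" "step u (Y' (Suc u)) (Y' u) (Z' u)" if "u < T" for u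
    using assms(1,2) that by (simp_all add: bsde_finite_iff)
qed (rule assms)

text \<open>At fixed \<open>t\<close> the finite horizon values are Cauchy in the horizon, which
  defines \<open>Y\<close>. No limit of the \<open>z\<close> is taken: a step back from the limit at
  \<open>t + 1\<close> is shown to land on the limit at \<open>t\<close>, and \<open>Z\<close> is
  read off from that step.\<close>

lemma bsde_infinite_exists:
  assumes C: "\<And>t. AE \<omega> in M. \<bar>f \<omega> t 0\<bar> \<le> C"
  shows "\<exists>Y Z. bsde_infinite M X f \<alpha> Y Z \<and> (\<forall>t. AE \<omega> in M. \<bar>Y t \<omega>\<bar> \<le> C / \<alpha>)"
proof -
  have "1 < 1 + \<alpha>" using discount_pos by simp
  have "0 \<le> C"
  proof -
    have "AE \<omega> in M. 0 \<le> C" using C[of 0] by eventually_elim simp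
    then show ?thesis by simp
  qed
  obtain y z where fin: "\<And>T. bsde_finite M X f \<alpha> T (y T) (z T)"
    using bsde_finite_exists by metis
  note yz = fin[unfolded bsde_finite_iff]
  have y_bound: "AE \<omega> in M. \<bar>y T t \<omega>\<bar> \<le> C / \<alpha>" if "t \<le> T" for t T
  proof (rule steps_bound[OF C that])
    show "AE \<omega> in M. \<bar>y T T \<omega>\<bar> \<le> C / \<alpha>"
      using yz[of T, THEN conjunct2, THEN conjunct1]
      by eventually_elim (use \<open>0 \<le> C\<close> discount_pos in simp)
  qed (use yz in auto)
  \<comment> \<open>Horizons start at \<open>t\<close>, since shorter ones leave the value at
    \<open>t\<close> unconstrained. On the null set without convergence \<open>lim\<close> is
    unspecified, but \<open>Y t\<close> is still measurable.\<close>
  define Y where "Y t \<omega> = lim (\<lambda>k. y (t + k) t \<omega>)" for t \<omega>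
  have "AE \<omega> in M. \<bar>y (t + k) t \<omega> - y (t + (k + l)) t \<omega>\<bar> \<le> C / \<alpha> / (1 + \<alpha>) ^ k" for t k l
    using bsde_finite_infinite_diff[OF fin[of "t + k"], of "y (t + (k + l))" "z (t + (k + l))" "C / \<alpha>" t]
      yz y_bound[of "t + k" "t + (k + l)"] by simp
  then have Cauchy: "AE \<omega> in M. \<forall>k l. \<bar>y (t + k) t \<omega> - y (t + (k + l)) t \<omega>\<bar> \<le> C / \<alpha> / (1 + \<alpha>) ^ k"
    for t by (simp add: AE_all_countable)
  have Y_diff: "AE \<omega> in M. \<bar>y (t + k) t \<omega> - Y t \<omega>\<bar> \<le> C / \<alpha> / (1 + \<alpha>) ^ k" for t k
    using Cauchy[of t]
  proof eventually_elim
    case (elim \<omega>)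
    then show ?case
      unfolding Y_def by (intro geometric_Cauchy_tendsto(2)[OF \<open>1 < 1 + \<alpha>\<close>]) auto
  qed
  have Y_bound: "AE \<omega> in M. \<bar>Y t \<omega>\<bar> \<le> C / \<alpha>" for t
  proof -
    have "AE \<omega> in M. \<forall>k. \<bar>y (t + k) t \<omega>\<bar> \<le> C / \<alpha>"
      using y_bound[of t] by (simp add: AE_all_countable)
    with Cauchy[of t] show ?thesis
    proof eventually_elim
      case (elim \<omega>)
      then have "(\<lambda>k. y (t + k) t \<omega>) \<longlonglongrightarrow> Y t \<omega>"
        unfolding Y_def by (intro geometric_Cauchy_tendsto(1)[OF \<open>1 < 1 + \<alpha>\<close>, where K = "C / \<alpha>"]) auto
      then have "(\<lambda>k. \<bar>y (t + k) t \<omega>\<bar>) \<longlonglongrightarrow> \<bar>Y t \<omega>\<bar>" by (rule tendsto_rabs)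
      then show ?case using elim by (intro LIMSEQ_le_const2) auto
    qed
  qed
  have Y_meas: "Y t \<in> borel_measurable (filt M X t)" for t
    unfolding Y_def
  proof (rule borel_measurable_lim_metric)
    show "y (t + k) t \<in> borel_measurable (filt M X t)" for k
      using fin[of "t + k"] by (simp add: bsde_finite_def)
  qed
  have "\<exists>Z. step t (Y (Suc t)) (Y t) Z" for t
  proof -
    obtain Y' Z where s: "step t (Y (Suc t)) Y' Z" using step_exists[OF Y_meas] by blast
    \<comment> \<open>Both are compared with the solution of horizon
      \<open>Suc t + k = t + Suc k\<close>, hence the factor 2. The gain of a further
      \<open>1 / (1 + \<alpha>)\<close> is given away.\<close>
    have "AE \<omega> in M. \<bar>Y' \<omega> - Y t \<omega>\<bar> \<le> (2 * (C / \<alpha>)) / (1 + \<alpha>) ^ k" for k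
    proof -
      have "AE \<omega> in M. \<bar>Y (Suc t) \<omega> - y (Suc t + k) (Suc t) \<omega>\<bar> \<le> C / \<alpha> / (1 + \<alpha>) ^ k"
        using Y_diff[of "Suc t" k] by (simp add: abs_minus_commute)
      moreover have "step t (y (Suc t + k) (Suc t)) (y (Suc t + k) t) (z (Suc t + k) t)"
        using yz[of "Suc t + k"] by simp
      ultimately have "AE \<omega> in M. \<bar>Y' \<omega> - y (Suc t + k) t \<omega>\<bar> \<le> C / \<alpha> / (1 + \<alpha>) ^ k / (1 + \<alpha>)"
        using step_contraction[OF s] by blast
      moreover have "AE \<omega> in M. \<bar>y (Suc t + k) t \<omega> - Y t \<omega>\<bar> \<le> C / \<alpha> / (1 + \<alpha>) ^ k / (1 + \<alpha>)"
        using Y_diff[of t "Suc k"] by (simp add: mult.commute mult.left_commute)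
      ultimately show ?thesis
      proof eventually_elim
        case (elim \<omega>)
        have "C / \<alpha> / (1 + \<alpha>) ^ k / (1 + \<alpha>) \<le> C / \<alpha> / (1 + \<alpha>) ^ k / 1"
          using \<open>0 \<le> C\<close> discount_pos by (intro divide_left_mono) auto
        with elim show ?case by simp
      qed
    qed
    then have zero: "AE \<omega> in M. Y' \<omega> - Y t \<omega> = 0"
      by (rule AE_zero_if_geometric_bound[OF \<open>1 < 1 + \<alpha>\<close>])
    have "step t (Y (Suc t)) (Y t) Z"
      unfolding step_def
    proof (intro conjI Y_meas)
      show "AE \<omega> in M. Y (Suc t) \<omega> =
          Y t \<omega> - (f \<omega> t (Z \<omega>) - \<alpha> * Y t \<omega>) + Z \<omega> \<bullet> mart_diff M X t \<omega>"
        using zero s[unfolded step_def, THEN conjunct2, THEN conjunct2]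
        by eventually_elim simp
    qed (use s in \<open>simp add: step_def\<close>)
    then show ?thesis by blast
  qed
  then obtain Z where "\<And>t. step t (Y (Suc t)) (Y t) (Z t)" by metis
  with Y_bound show ?thesis by (auto simp: bsde_infinite_iff)
qed

text \<open>The error decays in \<open>T - t\<close>, so the latest time in \<open>S\<close> has the
  slowest rate, and that rate serves all of \<open>S\<close>.\<close>

lemma bsde_finite_converges:
  assumes sol: "bsde_infinite M X f \<alpha> Y Z"
    and Y: "\<And>t. AE \<omega> in M. \<bar>Y t \<omega>\<bar> \<le> K"
    and YT: "\<And>T. bsde_finite M X f \<alpha> T (YT T) (ZT T)"
    and "finite S"
  shows "(\<lambda>T. SUP t\<in>S. Linfty_norm M (\<lambda>\<omega>. YT T t \<omega> - Y t \<omega>)) \<longlonglongrightarrow> 0"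
proof -
  define N where "N = Max S"
  have N: "t \<le> N" if "t \<in> S" for t using \<open>finite S\<close> that by (simp add: N_def)
  have "0 \<le> K"
  proof -
    have "AE \<omega> in M. 0 \<le> K" using Y[of 0] by eventually_elim simp
    then show ?thesis by simp
  qed
  have "1 < 1 + \<alpha>" using discount_pos by simp
  have bound: "(SUP t\<in>S. Linfty_norm M (\<lambda>\<omega>. YT T t \<omega> - Y t \<omega>)) \<le> ennreal (K / (1 + \<alpha>) ^ (T - N))"
    if "N \<le> T" for T
  proof (rule SUP_least)
    fix t assume "t \<in> S"
    then have t: "t \<le> N" "t \<le> T" using N that by fastforce+
    have [measurable]: "YT T t \<in> borel_measurable M" "Y t \<in> borel_measurable M"
      using YT[of T] sol t(2)
      by (auto simp: bsde_finite_def bsde_infinite_def intro: measurable_filt_imp_measurable)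
    have "AE \<omega> in M. \<bar>YT T t \<omega> - Y t \<omega>\<bar> \<le> K / (1 + \<alpha>) ^ (T - t)"
      using sol by (intro bsde_finite_infinite_diff[OF YT _ Y t(2)]) (auto simp: bsde_infinite_iff)
    then have "AE \<omega> in M. ennreal \<bar>YT T t \<omega> - Y t \<omega>\<bar> \<le> ennreal (K / (1 + \<alpha>) ^ (T - N))"
    proof eventually_elim
      case (elim \<omega>)
      also have "K / (1 + \<alpha>) ^ (T - t) \<le> K / (1 + \<alpha>) ^ (T - N)"
        using \<open>0 \<le> K\<close> discount_pos t by (intro divide_left_mono power_increasing) auto
      finally show ?case by (rule ennreal_leI)
    qed
    then show "Linfty_norm M (\<lambda>\<omega>. YT T t \<omega> - Y t \<omega>) \<le> ennreal (K / (1 + \<alpha>) ^ (T - N))"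
      unfolding Linfty_norm_def by (intro esssup_I) auto
  qed
  have "(\<lambda>T. K / (1 + \<alpha>) ^ (T - N)) \<longlonglongrightarrow> 0"
    using LIMSEQ_divide_realpow_zero[OF \<open>1 < 1 + \<alpha>\<close>, of K]
    \<comment> \<open>Shifting \<open>T\<close> by \<open>N\<close> removes the truncated
      subtraction.\<close>
    by - (rule LIMSEQ_offset[of _ N], simp)
  then have lim: "(\<lambda>T. ennreal (K / (1 + \<alpha>) ^ (T - N))) \<longlonglongrightarrow> 0"
    by (metis tendsto_ennrealI ennreal_0)
  show ?thesis
  proof (rule tendsto_sandwich[OF _ _ tendsto_const lim])
    \<comment> \<open>Only eventually: for \<open>T < N\<close> some times in \<open>S\<close> may
      lie beyond the horizon, where \<open>YT T\<close> is unconstrained.\<close>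
    show "\<forall>\<^sub>F T in sequentially. (SUP t\<in>S. Linfty_norm M (\<lambda>\<omega>. YT T t \<omega> - Y t \<omega>))
        \<le> ennreal (K / (1 + \<alpha>) ^ (T - N))"
      using eventually_ge_at_top[of N] by eventually_elim (rule bound)
  qed simp
qed

end

text \<open>Convergence is claimed for every choice of finite horizon solutions; the first clause
  provides such choices and their uniqueness. The supremum over a finite \<open>S\<close> expresses
  uniformity in time.\<close>

theorem theorem2p5:
  fixes M :: "'a measure"
    and X :: "nat \<Rightarrow> 'a \<Rightarrow> real^'n"
    and f :: "'a \<Rightarrow> nat \<Rightarrow> real^'n \<Rightarrow> real"
    and \<alpha> L C :: real
  assumes "basis_process M X"
    and "\<alpha> > 0"
    and "adapted_driver M X f"
    and "L > 0" and "lipschitz_driver M X f L"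
    and "balanced_driver M X f"
    and "C > 0" and "\<And>t. AE \<omega> in M. \<bar>f \<omega> t 0\<bar> \<le> C"
  shows "(\<forall>T. (\<exists>Y Z. bsde_finite M X f \<alpha> T Y Z) \<and>
              (\<forall>Y Z Y' Z'. bsde_finite M X f \<alpha> T Y Z \<and> bsde_finite M X f \<alpha> T Y' Z' \<longrightarrow>
                 (AE \<omega> in M. \<forall>t\<le>T. Y t \<omega> = Y' t \<omega>) \<and>
                 (\<forall>t<T. M_equiv_at M X t (Z t) (Z' t)))) \<and>
         (\<exists>Y Z. bsde_infinite M X f \<alpha> Y Z \<and>
              (\<forall>t. AE \<omega> in M. \<bar>Y t \<omega>\<bar> \<le> C / \<alpha>) \<and>
              (\<forall>Y' Z'. bsde_infinite M X f \<alpha> Y' Z' \<and> bounded_process M Y' \<longrightarrow>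
                 (AE \<omega> in M. \<forall>t. Y t \<omega> = Y' t \<omega>) \<and>
                 (\<forall>t. M_equiv_at M X t (Z t) (Z' t))) \<and>
              (\<forall>YT ZT. (\<forall>T. bsde_finite M X f \<alpha> T (YT T) (ZT T)) \<longrightarrow>
                 (\<forall>S. finite S \<longrightarrow>
                    (\<lambda>T. SUP t\<in>S. Linfty_norm M (\<lambda>\<omega>. YT T t \<omega> - Y t \<omega>)) \<longlonglongrightarrow> 0)))"
proof -
  interpret discounted_bsde M X f \<alpha>
    using assms by (simp add: discounted_bsde_def discounted_bsde_axioms_def)
  obtain Y Z where sol: "bsde_infinite M X f \<alpha> Y Z" and Y: "\<And>t. AE \<omega> in M. \<bar>Y t \<omega>\<bar> \<le> C / \<alpha>"
    using bsde_infinite_exists[OF assms(8)] by blast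
  then have bounded: "bounded_process M Y" by (auto simp: bounded_process_def)
  show ?thesis
  proof (rule conjI[OF _ exI[of _ Y, OF exI[of _ Z]]]; intro conjI allI impI)
    show "\<exists>Y Z. bsde_finite M X f \<alpha> T Y Z" for T by (rule bsde_finite_exists)
    show "AE \<omega> in M. \<forall>t\<le>T. y t \<omega> = y' t \<omega>"
      if "bsde_finite M X f \<alpha> T y z \<and> bsde_finite M X f \<alpha> T y' z'" for T y z y' z'
      using that bsde_finite_unique(1) by blast
    show "M_equiv_at M X t (z t) (z' t)"
      if "bsde_finite M X f \<alpha> T y z \<and> bsde_finite M X f \<alpha> T y' z'" "t < T" for T y z y' z' t
      using that bsde_finite_unique(2) by blast
    show "AE \<omega> in M. \<forall>t. Y t \<omega> = y t \<omega>"
      if "bsde_infinite M X f \<alpha> y z \<and> bounded_process M y" for y z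
      using that sol bounded bsde_infinite_unique(1) by blast
    show "M_equiv_at M X t (Z t) (z t)"
      if "bsde_infinite M X f \<alpha> y z \<and> bounded_process M y" for y z t
      using that sol bounded bsde_infinite_unique(2) by blast
    show "(\<lambda>T. SUP t\<in>S. Linfty_norm M (\<lambda>\<omega>. y T t \<omega> - Y t \<omega>)) \<longlonglongrightarrow> 0"
      if "\<forall>T. bsde_finite M X f \<alpha> T (y T) (z T)" "finite S" for y z S
      using that by (intro bsde_finite_converges[OF sol Y]) auto
  qed (rule sol Y)+
qed

end
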